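(* Let $b\ge 2$ be an integer. Then, as $x\to\infty$, \[\sum_{n\leq x}\frac{H_b(n)}{n}= C_b \log x +O_b(1),\] where \[C_b=\frac{1}{\zeta(b)}\prod_p\left[1+(p^{b+1}-1)\sum_{k=1}^{\infty}\frac{p^k}{p^{k(b+1)}(p^{b+1}-p)+p-1}\right],\] the product running over all primes $p$.
   Context: For an integer $b\ge 2$ and positive integers $m,n$, the generalized gcd is $(m,n)_b:=\max\{d\ge 1: d^b\mid m \text{ and } d^b\mid n\}$. The harmonic mean of the generalized gcd function is $H_b(n):=n\left(\sum_{1\le j\le n}\frac{1}{(j,n)_b}\right)^{-1}$. Here $\zeta$ is the Riemann zeta function, $x$ is a real variable, sums over $n\le x$ run over positive integers $n$, and $O_b$ means that the implied constant may depend on $b$. *)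

theory Defs
  imports
    "HOL-Analysis.Analysis"
    "HOL-Computational_Algebra.Primes"
    "HOL-Library.Landau_Symbols"
begin

definition gen_gcd :: "nat \<Rightarrow> nat \<Rightarrow> nat \<Rightarrow> nat" where
  "gen_gcd b m n = Max {d. d \<ge> 1 \<and> d ^ b dvd m \<and> d ^ b dvd n}"

definition harm_mean_gcd :: "nat \<Rightarrow> nat \<Rightarrow> real" where
  "harm_mean_gcd b n = real n * inverse (\<Sum>j=1..n. 1 / real (gen_gcd b j n))"

(* The Dirichlet series of the Riemann zeta function. It represents zeta only
   for s > 1, which covers the values zeta(b), b \<ge> 2, needed here. *)
definition riemann_zeta :: "real \<Rightarrow> real" where
  "riemann_zeta s = (\<Sum>n. 1 / real (Suc n) powr s)"

(* The inner series starts at k = 1, hence the index Suc k. *)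
definition euler_factor :: "nat \<Rightarrow> nat \<Rightarrow> real" where
  "euler_factor b p =
     1 + (real p ^ (b + 1) - 1) *
       (\<Sum>k. real p ^ Suc k /
          (real p ^ (Suc k * (b + 1)) * (real p ^ (b + 1) - real p) + real p - 1))"

(* The product over the primes is an infinite product over all naturals, with
   factor 1 at the non-primes. *)
definition C_const :: "nat \<Rightarrow> real" where
  "C_const b = 1 / riemann_zeta (real b) *
     (\<Prod>p. if prime p then euler_factor b p else 1)"

end

(*
The mean of 1/(j,n)_b over 1 <= j <= n is multiplicative in n, since 1/m is the divisor sum of the
multiplicative function with value (1-p)/p^k at p^k. At p^a this mean depends only on k = a div b;
it is local_sum b p k, which decreases in k from 1 and stays at least 1/2. Hence H_b(n), its
reciprocal, is the sum of G(d) over all d with d^b dividing n, where G = increment_fun b is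
multiplicative with 0 <= G <= 1. Summing over n <= x,

  sum H_b(n)/n = sum_d G(d)/d^b * harm(floor(x/d^b)),

and harm(floor(x/d^b)) differs from ln x by at most b ln d + 1 for every d >= 1, including those
with d^b > x. As G(d) (b ln d + 1)/d^b is summable, the main term is ln x * sum_d G(d)/d^b, and
Euler products for this series and for zeta(b) identify its coefficient with C_b.
*)
theory Submission
  imports Defs
begin

section \<open>Multiplicative functions\<close>

definition multiplicative :: "(nat \<Rightarrow> real) \<Rightarrow> bool" where
  "multiplicative f \<longleftrightarrow> f 1 = 1 \<and>
     (\<forall>m n. m > 0 \<longrightarrow> n > 0 \<longrightarrow> coprime m n \<longrightarrow> f (m * n) = f m * f n)"

lemma multiplicative_one: "multiplicative f \<Longrightarrow> f (Suc 0) = 1"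
  by (simp add: multiplicative_def)

lemma multiplicative_mult:
  "multiplicative f \<Longrightarrow> m > 0 \<Longrightarrow> n > 0 \<Longrightarrow> coprime m n \<Longrightarrow> f (m * n) = f m * f n"
  by (simp add: multiplicative_def)

lemma prime_power_coprime_decompE:
  fixes n :: nat
  assumes "n > 1"
  obtains p k m where "prime p" "k > 0" "m > 0" "m < n" "n = p ^ k * m" "coprime (p ^ k) m"
proof -
  obtain p where p: "prime p" "p dvd n"
    using assms prime_factor_nat[of n] by auto
  have n0: "n \<noteq> 0" "\<not> is_unit p" using assms p by auto
  obtain m where m: "n = p ^ multiplicity p n * m" "\<not> p dvd m"
    by (rule multiplicity_decompose'[OF n0])
  define k where "k = multiplicity p n"
  have n: "n = p ^ k * m" using m(1) by (simp add: k_def)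
  have k: "k > 0" using p n0 by (simp add: k_def prime_multiplicity_gt_zero_iff)
  have cop: "coprime (p ^ k) m" using m(2) p(1) k by (simp add: prime_imp_coprime)
  have m0: "m > 0" using m(2) by (cases m) auto
  have pk: "p ^ k > 1" by (rule one_less_power[OF prime_gt_1_nat[OF p(1)] k])
  have "m < n" using m0 pk by (simp add: n)
  show ?thesis by (rule that[OF p(1) k m0 \<open>m < n\<close> n cop])
qed

text \<open>Strong induction: the full power of one prime is split off, leaving a smaller cofactor
  coprime to it.\<close>

lemma multiplicative_eqI:
  assumes "multiplicative f" "multiplicative g"
    and "\<And>p k. prime p \<Longrightarrow> k > 0 \<Longrightarrow> f (p ^ k) = g (p ^ k)"
    and "n > 0"
  shows "f n = g n"
  using assms(4)
proof (induction n rule: less_induct)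
  case (less n)
  show ?case
  proof (cases "n = 1")
    case True
    then show ?thesis using assms(1,2) by (simp add: multiplicative_one)
  next
    case False
    then have "n > 1" using less.prems by simp
    then obtain p k m where *: "prime p" "k > 0" "m > 0" "m < n" "n = p ^ k * m" "coprime (p ^ k) m"
      by (rule prime_power_coprime_decompE)
    have "p ^ k > 0" using *(1) by (simp add: prime_gt_0_nat)
    then show ?thesis
      using * less.IH[OF *(4,3)] assms(3)[OF *(1,2)]
      by (simp add: multiplicative_mult[OF assms(1)] multiplicative_mult[OF assms(2)])
  qed
qed

text \<open>Only exponents \<open>k > 0\<close> are ever read from \<open>c\<close>. The formulas
  supplied below may therefore be wrong at \<open>k = 0\<close>, where the empty product gives the
  required value 1.\<close>

definition mult_extension :: "(nat \<Rightarrow> nat \<Rightarrow> real) \<Rightarrow> nat \<Rightarrow> real" where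
  "mult_extension c n = (\<Prod>p\<in>prime_factors n. c p (multiplicity p n))"

lemma mult_extension_prime_power:
  assumes "prime p"
  shows "mult_extension c (p ^ k) = (if k = 0 then 1 else c p k)"
  using assms by (simp add: mult_extension_def prime_factorization_prime_power)

text \<open>Coprime numbers have disjoint prime factors, and every prime factor keeps its
  multiplicity in the product.\<close>

lemma multiplicative_mult_extension: "multiplicative (mult_extension c)"
  unfolding multiplicative_def
proof (intro conjI allI impI)
  show "mult_extension c 1 = 1" by (simp add: mult_extension_def)
next
  fix m n :: nat
  assume mn: "m > 0" "n > 0" "coprime m n"
  have disj: "prime_factors m \<inter> prime_factors n = {}"
    using mn(3) by (metis coprime_common_divisor disjoint_iff in_prime_factors_imp_dvd
        in_prime_factors_imp_prime not_prime_unit)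
  have m: "multiplicity p (m * n) = multiplicity p m" if "p \<in> prime_factors m" for p
  proof -
    have "p \<notin> prime_factors n" "prime p" using that disj by auto
    then have "\<not> p dvd n" using mn by (auto simp: prime_factors_dvd)
    then show ?thesis using \<open>prime p\<close> mn
      by (simp add: prime_elem_multiplicity_mult_distrib not_dvd_imp_multiplicity_0)
  qed
  have n: "multiplicity p (m * n) = multiplicity p n" if "p \<in> prime_factors n" for p
  proof -
    have "p \<notin> prime_factors m" "prime p" using that disj by auto
    then have "\<not> p dvd m" using mn by (auto simp: prime_factors_dvd)
    then show ?thesis using \<open>prime p\<close> mn
      by (simp add: prime_elem_multiplicity_mult_distrib not_dvd_imp_multiplicity_0)
  qed
  have "prime_factors (m * n) = prime_factors m \<union> prime_factors n"
    using mn by (simp add: prime_factors_product)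
  then have "mult_extension c (m * n) =
      (\<Prod>p\<in>prime_factors m. c p (multiplicity p (m * n))) *
      (\<Prod>p\<in>prime_factors n. c p (multiplicity p (m * n)))"
    unfolding mult_extension_def by (simp only: prod.union_disjoint[OF _ _ disj] finite_set_mset)
  also have "\<dots> = mult_extension c m * mult_extension c n"
    unfolding mult_extension_def by (intro arg_cong2[of _ _ _ _ "(*)"] prod.cong) (simp_all only: m n)
  finally show "mult_extension c (m * n) = mult_extension c m * mult_extension c n" .
qed

section \<open>Sums over all d whose b-th power divides n\<close>

definition power_divisor_sum :: "nat \<Rightarrow> (nat \<Rightarrow> real) \<Rightarrow> nat \<Rightarrow> real" where
  "power_divisor_sum b g n = (\<Sum>d | d ^ b dvd n. g d)"

lemma power_divisor_le:
  fixes d n :: nat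
  assumes "b > 0" "n > 0" "d ^ b dvd n"
  shows "d \<le> n"
proof -
  have "d \<le> d ^ b" using assms(1) by (cases "d = 0") (simp_all add: self_le_power)
  also have "\<dots> \<le> n" using assms by (simp add: dvd_imp_le)
  finally show ?thesis .
qed

lemma finite_power_divisors: "b > 0 \<Longrightarrow> n > 0 \<Longrightarrow> finite {d::nat. d ^ b dvd n}"
  by (rule finite_subset[of _ "{..n}"]) (use power_divisor_le[of b n] in auto)

lemma power_divisor_pos: "b > 0 \<Longrightarrow> n > 0 \<Longrightarrow> (d::nat) ^ b dvd n \<Longrightarrow> d > 0"
  by (metis dvd_0_left neq0_conv zero_power)

lemma power_divisor_sum_prime_power:
  assumes "b > 0" "prime p"
  shows "power_divisor_sum b g (p ^ a) = (\<Sum>k\<le>a div b. g (p ^ k))"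
proof -
  have "{d. d ^ b dvd p ^ a} = (\<lambda>k. p ^ k) ` {..a div b}"
  proof (intro equalityI subsetI)
    fix d assume "d \<in> {d. d ^ b dvd p ^ a}"
    then have d: "d ^ b dvd p ^ a" by simp
    have "d dvd d ^ b" using assms by (simp add: dvd_power)
    then have "d dvd p ^ a" using d dvd_trans by blast
    then obtain k where "d = p ^ k" using divides_primepow_nat[OF assms(2)] by auto
    moreover have "k * b \<le> a"
      using d \<open>d = p ^ k\<close> power_dvd_imp_le prime_gt_1_nat[OF assms(2)] by (metis power_mult)
    ultimately show "d \<in> (\<lambda>k. p ^ k) ` {..a div b}"
      using assms(1) by (auto simp: less_eq_div_iff_mult_less_eq)
  next
    fix d assume "d \<in> (\<lambda>k. p ^ k) ` {..a div b}"
    then obtain k where "d = p ^ k" "k * b \<le> a"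
      using assms(1) by (auto simp: less_eq_div_iff_mult_less_eq)
    then show "d \<in> {d. d ^ b dvd p ^ a}" by (auto simp flip: power_mult simp: le_imp_power_dvd)
  qed
  moreover have "inj_on (\<lambda>k. p ^ k) {..a div b}"
    using prime_gt_1_nat[OF assms(2)] by (auto simp: inj_on_def)
  ultimately show ?thesis unfolding power_divisor_sum_def by (simp add: sum.reindex)
qed

text \<open>Each \<open>d\<close> with \<open>d ^ b dvd m * n\<close> is uniquely
  \<open>x * y\<close> with \<open>x ^ b dvd m\<close> and \<open>y ^ b dvd n\<close>, so the sum
  factors over such pairs.\<close>

lemma multiplicative_power_divisor_sum:
  assumes b: "b > 0" and g: "multiplicative g"
  shows "multiplicative (power_divisor_sum b g)"
  unfolding multiplicative_def
proof (intro conjI allI impI)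
  have "{d::nat. d ^ b dvd 1} = {1}" using b is_unit_power_iff[of _ b] by auto
  then show "power_divisor_sum b g 1 = 1"
    using g by (simp add: power_divisor_sum_def multiplicative_one)
next
  fix m n :: nat
  assume mn: "m > 0" "n > 0" "coprime m n"
  let ?A = "{d. d ^ b dvd m}" and ?B = "{d. d ^ b dvd n}"
  have cop: "coprime x y" if "x \<in> ?A" "y \<in> ?B" for x y
  proof -
    have "coprime (x ^ b) (y ^ b)" using that mn(3) coprime_divisors by blast
    then show ?thesis using b by simp
  qed
  have img: "{d. d ^ b dvd m * n} = (\<lambda>(x, y). x * y) ` (?A \<times> ?B)"
  proof (intro equalityI subsetI)
    fix d assume "d \<in> {d. d ^ b dvd m * n}"
    then have d: "d ^ b dvd m * n" by simp
    have "d dvd d ^ b" using b by (simp add: dvd_power)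
    then have "d dvd m * n" using d dvd_trans by blast
    then obtain x y where xy: "d = x * y" "x dvd m" "y dvd n" using division_decomp by blast
    have "x ^ b dvd m * n" "y ^ b dvd m * n"
      using d xy(1) by (auto simp: power_mult_distrib dest: dvd_mult_left dvd_mult_right)
    \<comment> \<open>A divisor of \<open>m\<close> is coprime to \<open>n\<close>, so
      \<open>n\<close> can be cancelled from \<open>x ^ b dvd m * n\<close>; symmetrically for
      \<open>y\<close>.\<close>
    moreover have "coprime x n" "coprime m y"
      using xy mn(3) coprime_divisors dvd_refl by blast+
    then have "coprime (x ^ b) n" "coprime (y ^ b) m" by (simp_all add: coprime_commute)
    ultimately have "x ^ b dvd m" "y ^ b dvd n"
      by (simp_all add: coprime_dvd_mult_left_iff coprime_dvd_mult_right_iff)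
    then show "d \<in> (\<lambda>(x, y). x * y) ` (?A \<times> ?B)" using xy(1) by auto
  next
    fix d assume "d \<in> (\<lambda>(x, y). x * y) ` (?A \<times> ?B)"
    then show "d \<in> {d. d ^ b dvd m * n}" by (auto simp: power_mult_distrib mult_dvd_mono)
  qed
  have inj: "inj_on (\<lambda>(x, y). x * y) (?A \<times> ?B)"
  proof (rule inj_onI, clarify)
    fix x y x' y' :: nat
    assume *: "x ^ b dvd m" "y ^ b dvd n" "x' ^ b dvd m" "y' ^ b dvd n" "x * y = x' * y'"
    have "coprime x y'" "coprime x' y" using cop * by auto
    then have "x dvd x'" "x' dvd x"
      using *(5) by (metis coprime_dvd_mult_left_iff dvd_triv_left)+
    then have "x = x'" by (simp add: dvd_antisym)
    moreover have "x > 0" using power_divisor_pos[OF b mn(1) *(1)] .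
    ultimately show "x = x' \<and> y = y'" using *(5) by simp
  qed
  have "power_divisor_sum b g (m * n) = (\<Sum>(x, y)\<in>?A \<times> ?B. g (x * y))"
    unfolding power_divisor_sum_def img by (subst sum.reindex[OF inj]) (simp add: case_prod_unfold)
  also have "\<dots> = (\<Sum>(x, y)\<in>?A \<times> ?B. g x * g y)"
    using cop power_divisor_pos[OF b mn(1)] power_divisor_pos[OF b mn(2)] multiplicative_mult[OF g]
    by (intro sum.cong) auto
  also have "\<dots> = power_divisor_sum b g m * power_divisor_sum b g n"
    unfolding power_divisor_sum_def by (simp add: sum_product sum.cartesian_product)
  finally show "power_divisor_sum b g (m * n) = power_divisor_sum b g m * power_divisor_sum b g n" .
qed

section \<open>The generalized gcd\<close>

text \<open>\<open>Max\<close> selects by size; the maximum \<open>M\<close> turns out to be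
  greatest for divisibility too. If \<open>d\<close> is admissible, so is the lcm of
  \<open>d\<close> and \<open>M\<close>, written \<open>g * x * y\<close> with \<open>g\<close>
  their gcd. Maximality of \<open>M = g * y\<close> forces \<open>x = 1\<close>, hence
  \<open>d\<close> divides \<open>M\<close>.\<close>

lemma dvd_gen_gcd_iff:
  assumes "b > 0" "m > 0" "n > 0"
  shows "d dvd gen_gcd b m n \<longleftrightarrow> d ^ b dvd m \<and> d ^ b dvd n"
proof -
  let ?S = "{d::nat. d \<ge> 1 \<and> d ^ b dvd m \<and> d ^ b dvd n}"
  define M where "M = gen_gcd b m n"
  have fin: "finite ?S" by (rule finite_subset[OF _ finite_power_divisors[OF assms(1,2)]]) auto
  have "1 \<in> ?S" by simp
  then have "M \<in> ?S" unfolding M_def gen_gcd_def using Max_in[OF fin] by blast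
  then have M: "M > 0" "M ^ b dvd m" "M ^ b dvd n" by auto
  have max: "x \<le> M" if "x ^ b dvd m" "x ^ b dvd n" "x > 0" for x
    unfolding M_def gen_gcd_def using that by (intro Max_ge fin) auto
  have lcm: "(g * x * y) ^ b dvd k"
    if "coprime x y" "(g * x) ^ b dvd k" "(g * y) ^ b dvd k" "g > 0" for g x y k :: nat
  proof -
    from that(2) obtain l where l: "k = g ^ b * l" by (auto simp: power_mult_distrib)
      (metis dvd_def mult.assoc)
    have "x ^ b dvd l" "y ^ b dvd l" using that l by (auto simp: power_mult_distrib)
    moreover have "coprime (x ^ b) (y ^ b)" using that(1) by simp
    ultimately have "x ^ b * y ^ b dvd l" by (rule divides_mult)
    then show ?thesis using l by (simp add: power_mult_distrib mult.assoc)
  qed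
  have "d dvd M" if d: "d ^ b dvd m" "d ^ b dvd n"
  proof -
    have d0: "d > 0" using power_divisor_pos[OF assms(1,2) d(1)] .
    define g where "g = gcd d M"
    have g0: "g > 0" using d0 by (simp add: g_def)
    obtain x y where xy: "d = g * x" "M = g * y" "coprime x y"
      using gcd_coprime_exists[of d M] d0 unfolding g_def by (metis gcd_eq_0_iff mult.commute neq0_conv)
    have pos: "x > 0" "y > 0" using xy d0 M(1) by auto
    have "g * x * y \<le> M"
      using lcm[OF xy(3)] d M xy g0 pos by (intro max) auto
    then have "x = 1" using xy(2) pos g0 by auto
    then show ?thesis using xy by simp
  qed
  moreover have "d ^ b dvd m \<and> d ^ b dvd n" if "d dvd M"
    using that M dvd_power_same dvd_trans by blast
  ultimately show ?thesis unfolding M_def by blast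
qed

lemma gen_gcd_pos:
  assumes "b > 0" "m > 0" "n > 0"
  shows "gen_gcd b m n > 0"
  using dvd_gen_gcd_iff[OF assms, of 0] assms by (metis dvd_0_left dvd_refl neq0_conv zero_power)

section \<open>Euler products\<close>

text \<open>A finite Euler product. Adding a prime \<open>p\<close> to \<open>A\<close> corresponds
  to writing each number uniquely as \<open>p ^ k * m\<close> with \<open>m\<close> free of
  \<open>p\<close>; nonnegativity permits summing over the pairs \<open>(m, k)\<close> in any
  order.\<close>

lemma has_sum_smooth_numbers:
  fixes u :: "nat \<Rightarrow> real"
  assumes u: "multiplicative u" "\<And>n. u n \<ge> 0"
    and "finite A" "\<And>p. p \<in> A \<Longrightarrow> prime p" "\<And>p. p \<in> A \<Longrightarrow> summable (\<lambda>k. u (p ^ k))"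
  shows "(u has_sum (\<Prod>p\<in>A. \<Sum>k. u (p ^ k))) {n. n > 0 \<and> prime_factors n \<subseteq> A}"
  using assms(3-5)
proof (induction A rule: finite_induct)
  case empty
  have "{n::nat. n > 0 \<and> prime_factors n \<subseteq> {}} = {1}"
    by (auto simp: prime_factorization_empty_iff)
  moreover have "(u has_sum u 1) {1}" using has_sum_finite[of "{1}" u] by simp
  ultimately show ?case using multiplicative_one[OF u(1)] by simp
next
  case (insert p A)
  let ?S = "\<lambda>A. {n::nat. n > 0 \<and> prime_factors n \<subseteq> A}"
  define a where "a = (\<Sum>k. u (p ^ k))"
  define c where "c = (\<Prod>p\<in>A. \<Sum>k. u (p ^ k))"
  have p: "prime p" using insert.prems by simp
  have pe: "prime_elem p" using p by simp
  have ndvd: "\<not> p dvd m" if "m \<in> ?S A" for m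
    using that insert.hyps p by (auto simp: prime_factors_dvd)
  have sums: "((\<lambda>k. u (p ^ k)) has_sum a) UNIV"
    unfolding a_def using insert.prems(2)[of p] u(2)
    by (intro sums_nonneg_imp_has_sum summable_sums) auto
  have c: "(u has_sum c) (?S A)" unfolding c_def using insert.IH insert.prems by simp
  have fib: "((\<lambda>k. u m * u (p ^ k)) has_sum u m * a) UNIV" for m
    by (rule has_sum_cmult_right[OF sums])
  have ca: "((\<lambda>m. u m * a) has_sum c * a) (?S A)" by (rule has_sum_cmult_left[OF c])
  have "((\<lambda>(m, k). u m * u (p ^ k)) has_sum c * a) (?S A \<times> UNIV)"
  proof (rule has_sum_SigmaI)
    show "(\<lambda>(m, k). u m * u (p ^ k)) summable_on ?S A \<times> UNIV"
      using fib u(2) has_sum_imp_summable[OF ca]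
      by (intro summable_on_SigmaI[where g = "\<lambda>m. u m * a"]) auto
  qed (use fib ca in auto)
  moreover have "((\<lambda>(m, k). u m * u (p ^ k)) has_sum c * a) (?S A \<times> UNIV) \<longleftrightarrow>
      (u has_sum c * a) (?S (insert p A))"
  proof (rule has_sum_reindex_bij_witness[where
        j = "\<lambda>(m, k). p ^ k * m" and i = "\<lambda>n. (n div p ^ multiplicity p n, multiplicity p n)"])
    fix x :: "nat \<times> nat"
    assume x: "x \<in> ?S A \<times> UNIV"
    obtain m k where [simp]: "x = (m, k)" by force
    have m: "m > 0" "prime_factors m \<subseteq> A" "\<not> p dvd m" using x ndvd by auto
    have pk: "p ^ k > 0" using p by (simp add: prime_gt_0_nat)
    have mult: "multiplicity p (p ^ k * m) = k"
      using m p pk by (simp add: prime_elem_multiplicity_mult_distrib not_dvd_imp_multiplicity_0)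
    show "(case x of (m, k) \<Rightarrow> p ^ k * m) \<in> ?S (insert p A)"
      using m pk p by (cases "k = 0") (auto simp: prime_factors_product prime_factorization_prime_power)
    show "(case (case x of (m, k) \<Rightarrow> p ^ k * m) of n \<Rightarrow> (n div p ^ multiplicity p n, multiplicity p n)) = x"
      using pk by (simp add: mult)
    have "coprime (p ^ k) m" using m(3) p by (simp add: prime_imp_coprime)
    then show "u (case x of (m, k) \<Rightarrow> p ^ k * m) = (case x of (m, k) \<Rightarrow> u m * u (p ^ k))"
      using multiplicative_mult[OF u(1) pk m(1)] by simp
  next
    fix n assume n: "n \<in> ?S (insert p A)"
    have dvd: "p ^ multiplicity p n dvd n" by (rule multiplicity_dvd)
    then have eq: "p ^ multiplicity p n * (n div p ^ multiplicity p n) = n" by simp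
    then show "(case (n div p ^ multiplicity p n, multiplicity p n) of (m, k) \<Rightarrow> p ^ k * m) = n" by simp
    have nd: "\<not> p dvd n div p ^ multiplicity p n"
      using n p by (intro multiplicity_decompose) auto
    have pos: "n div p ^ multiplicity p n > 0" using nd by (cases "n div p ^ multiplicity p n = 0") simp_all
    have "prime_factors (n div p ^ multiplicity p n) \<subseteq> prime_factors n"
      using n eq by (intro dvd_prime_factors) (auto intro: dvdI[of _ _ "p ^ multiplicity p n"] simp: mult.commute)
    moreover have "p \<notin> prime_factors (n div p ^ multiplicity p n)" using nd by (auto simp: prime_factors_dvd)
    ultimately show "(n div p ^ multiplicity p n, multiplicity p n) \<in> ?S A \<times> UNIV"
      using n pos by auto
  qed simp
  ultimately show ?case using insert.hyps by (simp add: a_def c_def mult.commute)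
qed

lemma summable_prime_powers:
  fixes u :: "nat \<Rightarrow> real"
  assumes "summable u" "\<And>n. u n \<ge> 0" "prime p"
  shows "summable (\<lambda>k. u (p ^ k))"
proof -
  have "u summable_on UNIV" using assms(1,2) by (rule summable_nonneg_imp_summable_on)
  then have "u summable_on range (\<lambda>k. p ^ k)" by (rule summable_on_subset_banach) simp
  moreover have "inj (\<lambda>k. p ^ k)" using prime_gt_1_nat[OF assms(3)] by (auto simp: inj_on_def)
  ultimately have "(\<lambda>k. u (p ^ k)) summable_on UNIV" by (simp add: summable_on_reindex o_def)
  then show ?thesis by (rule summable_on_imp_summable)
qed

text \<open>The partial product sums \<open>u\<close> over the positive numbers with all prime
  factors at most \<open>N\<close>. These include 1 to \<open>N\<close>, so the product is squeezed
  between a partial sum and the full sum. The series also has a term at 0, which no product of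
  primes reaches, hence \<open>u 0 = 0\<close>.\<close>

lemma euler_product_LIMSEQ:
  fixes u :: "nat \<Rightarrow> real"
  assumes u: "multiplicative u" "\<And>n. u n \<ge> 0" "u 0 = 0" "summable u"
  shows "(\<lambda>N. \<Prod>p\<le>N. if prime p then \<Sum>k. u (p ^ k) else 1) \<longlonglongrightarrow> suminf u"
proof -
  define P where "P N = (\<Prod>p\<le>N. if prime p then \<Sum>k. u (p ^ k) else 1)" for N :: nat
  let ?S = "\<lambda>N. {n. n > 0 \<and> prime_factors n \<subseteq> {p\<in>{..N}. prime p}}"
  have P: "(u has_sum P N) (?S N)" for N
  proof -
    have "P N = (\<Prod>p\<in>{p\<in>{..N}. prime p}. \<Sum>k. u (p ^ k))"
      unfolding P_def by (rule prod.inter_filter[symmetric]) simp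
    moreover have "(u has_sum (\<Prod>p\<in>{p\<in>{..N}. prime p}. \<Sum>k. u (p ^ k))) (?S N)"
      by (rule has_sum_smooth_numbers[OF u(1,2)]) (simp_all add: summable_prime_powers[OF u(4,2)])
    ultimately show ?thesis by (simp only:)
  qed
  have U: "(u has_sum suminf u) UNIV"
    using u(2,4) by (intro sums_nonneg_imp_has_sum summable_sums)
  have upper: "P N \<le> suminf u" for N
    by (rule has_sum_mono2[OF P U]) (use u(2) in auto)
  have lower: "sum u {..N} \<le> P N" for N
  proof -
    have "sum u {..N} = sum u {1..N}"
      using u(3) by (intro sum.mono_neutral_right) (auto simp: not_le)
    moreover have "(u has_sum sum u {1..N}) {1..N}" by (rule has_sum_finite) simp
    moreover have "{1..N} \<subseteq> ?S N"
    proof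
      fix n assume n: "n \<in> {1..N}"
      have "p \<le> N" if "p \<in> prime_factors n" for p
        using that n dvd_imp_le[of p n] by (auto simp: prime_factors_dvd)
      then show "n \<in> ?S N" using n by auto
    qed
    ultimately show ?thesis using has_sum_mono2[OF _ P[of N]] u(2) by metis
  qed
  have "P \<longlonglongrightarrow> suminf u"
    by (rule tendsto_sandwich[OF _ _ summable_LIMSEQ'[OF u(4)] tendsto_const])
      (use lower upper in \<open>auto intro!: always_eventually\<close>)
  then show ?thesis unfolding P_def .
qed

section \<open>The harmonic mean as a divisor sum\<close>

text \<open>The mean of \<open>1 / (j, p ^ a)\<^sub>b\<close> over \<open>1 \<le> j \<le> p ^ a\<close>, where \<open>a div b = m\<close>.\<close>

definition local_sum :: "nat \<Rightarrow> nat \<Rightarrow> nat \<Rightarrow> real" where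
  "local_sum b p m = (real p ^ (b + 1) - p + (real p - 1) / (real p ^ (b + 1)) ^ m) / (real p ^ (b + 1) - 1)"

text \<open>The lower bound comes from \<open>2 * p <= Q\<close> for \<open>Q = p ^ (b + 1)\<close>.
  Together the bounds place \<open>1 / local_sum b p m\<close> in [1, 2] and make it nondecreasing
  in \<open>m\<close>, so that its increments lie in [0, 1].\<close>

lemma local_sum_bounds:
  assumes "b \<ge> 1" "p \<ge> 2"
  shows "local_sum b p m \<le> 1" "local_sum b p m \<ge> 1 / 2" "local_sum b p (Suc m) \<le> local_sum b p m"
proof -
  define Q where "Q = real p ^ (b + 1)"
  have "real p ^ 2 \<le> Q" unfolding Q_def using assms by (intro power_increasing) auto
  moreover have "2 * real p \<le> real p ^ 2" using assms by (simp add: power2_eq_square)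
  ultimately have Q: "2 * p \<le> Q" by linarith
  then have Q1: "Q > 1" using assms by simp
  then have Qm: "Q ^ m \<ge> 1" by (simp add: one_le_power)
  have "(real p - 1) / Q ^ m \<le> real p - 1"
    using Qm assms by (simp add: divide_le_eq_1 divide_le_eq mult_le_cancel_left1)
  then show "local_sum b p m \<le> 1"
    using Q1 unfolding local_sum_def Q_def[symmetric] by simp
  have "(real p - 1) / Q ^ m \<ge> 0" using Qm assms by simp
  moreover have "(Q - p) \<ge> (Q - 1) / 2" using Q by simp
  ultimately have "(Q - 1) / 2 \<le> Q - p + (real p - 1) / Q ^ m" by linarith
  then show "local_sum b p m \<ge> 1 / 2"
    using Q1 unfolding local_sum_def Q_def[symmetric] by (simp add: field_simps)
  have "(real p - 1) / Q ^ Suc m \<le> (real p - 1) / Q ^ m"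
    using Q1 Qm assms by (intro divide_left_mono) (auto simp: mult_le_cancel_right1)
  then show "local_sum b p (Suc m) \<le> local_sum b p m"
    using Q1 unfolding local_sum_def Q_def[symmetric] by (intro divide_right_mono) auto
qed

text \<open>A geometric sum with ratio \<open>1 / p ^ (b + 1)\<close>. The summands are the values
  at \<open>d = p ^ k\<close> of \<open>recip_mobius d / d ^ b\<close>, with
  \<open>recip_mobius\<close> introduced below.\<close>

lemma local_sum_eq:
  assumes "p \<ge> 2"
  shows "local_sum b p m = (\<Sum>k\<le>m. if k = 0 then 1 else (1 - real p) / (real p ^ k * real (p ^ k) ^ b))"
proof (induction m)
  case 0
  have "real p ^ (b + 1) > 1" using assms by (intro one_less_power) auto
  then show ?case by (simp add: local_sum_def)
next
  case (Suc m)
  define Q where "Q = real p ^ (b + 1)"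
  have Q: "Q > 1" unfolding Q_def using assms by (intro one_less_power) auto
  have "real p ^ Suc m * real (p ^ Suc m) ^ b = Q ^ Suc m"
    unfolding Q_def by (simp add: power_mult [symmetric] algebra_simps power_add)
  then have "(\<Sum>k\<le>Suc m. if k = 0 then 1 else (1 - real p) / (real p ^ k * real (p ^ k) ^ b))
      = local_sum b p m + (1 - real p) / Q ^ Suc m" by (simp add: Suc)
  also have "\<dots> = local_sum b p (Suc m)"
    using Q unfolding local_sum_def Q_def[symmetric] by (simp add: divide_simps) (simp add: algebra_simps)
  finally show ?case by simp
qed

text \<open>Chosen so that the values at 1, p, ..., p^m telescope to
  \<open>1 / local_sum b p m\<close>, the local value of the harmonic mean.\<close>

definition increment_fun :: "nat \<Rightarrow> nat \<Rightarrow> real" where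
  "increment_fun b = mult_extension (\<lambda>p k. 1 / local_sum b p k - 1 / local_sum b p (k - 1))"

lemma local_sum_0: "p \<ge> 2 \<Longrightarrow> local_sum b p 0 = 1"
  by (simp add: local_sum_eq)

lemma sum_increment_fun_prime_power:
  assumes "prime p"
  shows "(\<Sum>k\<le>m. increment_fun b (p ^ k)) = 1 / local_sum b p m"
proof (induction m)
  case 0
  show ?case using local_sum_0[OF prime_ge_2_nat[OF assms]] mult_extension_prime_power[OF assms, of _ 0]
    by (simp add: increment_fun_def)
next
  case (Suc m)
  have "increment_fun b (p ^ Suc m) = 1 / local_sum b p (Suc m) - 1 / local_sum b p m"
    unfolding increment_fun_def by (simp only: mult_extension_prime_power[OF assms]) simp
  then show ?case by (simp add: Suc del: power_Suc)
qed

lemma increment_fun_bounds: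
  assumes "b \<ge> 1"
  shows "0 \<le> increment_fun b n \<and> increment_fun b n \<le> 1"
proof -
  have *: "0 \<le> 1 / local_sum b p k - 1 / local_sum b p (k - 1) \<and>
      1 / local_sum b p k - 1 / local_sum b p (k - 1) \<le> 1"
    if "prime p" for p k
  proof (cases k)
    case (Suc m)
    note p = prime_ge_2_nat[OF that]
    have b: "1 / 2 \<le> local_sum b p k" "local_sum b p k \<le> local_sum b p m"
      "local_sum b p m \<le> 1" "1 / 2 \<le> local_sum b p m"
      using local_sum_bounds[OF assms p] Suc by auto
    have "1 / local_sum b p m \<le> 1 / local_sum b p k" using b by (intro divide_left_mono) auto
    moreover have "1 / local_sum b p k \<le> 2" using b by (simp add: divide_le_eq)
    moreover have "1 \<le> 1 / local_sum b p m" using b by (simp add: le_divide_eq)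
    ultimately show ?thesis using Suc by simp
  \<comment> \<open>For \<open>k = 0\<close> truncated subtraction makes the two terms equal, so the
    difference is 0.\<close>
  qed simp
  show ?thesis unfolding increment_fun_def mult_extension_def
    using * by (intro conjI prod_nonneg prod_le_1) (auto dest: in_prime_factors_imp_prime)
qed

lemma multiplicative_increment_fun: "multiplicative (increment_fun b)"
  unfolding increment_fun_def by (rule multiplicative_mult_extension)

section \<open>Divisor sums for the reciprocal of the generalized gcd\<close>

lemma multiplicative_inverse: "multiplicative f \<Longrightarrow> multiplicative (\<lambda>n. 1 / f n)"
  by (simp add: multiplicative_def)

lemma multiplicative_divide_power: "multiplicative f \<Longrightarrow> multiplicative (\<lambda>n. f n / real n ^ b)"
  by (simp add: multiplicative_def power_mult_distrib)

lemma sum_multiples: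
  fixes c N :: nat and h :: "nat \<Rightarrow> real"
  assumes "c > 0"
  shows "(\<Sum>n | n \<in> {1..N} \<and> c dvd n. h n) = (\<Sum>k=1..N div c. h (c * k))"
proof -
  have "{n. n \<in> {1..N} \<and> c dvd n} = (\<lambda>k. c * k) ` {1..N div c}"
    using assms by (auto simp: less_eq_div_iff_mult_less_eq mult.commute dvd_def Suc_le_eq)
  then show ?thesis using assms by (simp add: sum.reindex inj_on_def)
qed

text \<open>The Moebius inverse of 1/n: its value at p^k is the difference 1/p^k -
  1/p^(k-1).\<close>

definition recip_mobius :: "nat \<Rightarrow> real" where
  "recip_mobius = mult_extension (\<lambda>p k. (1 - real p) / real p ^ k)"

lemma multiplicative_recip_mobius: "multiplicative recip_mobius"
  unfolding recip_mobius_def by (rule multiplicative_mult_extension)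

lemma recip_mobius_prime_power:
  "prime p \<Longrightarrow> recip_mobius (p ^ k) = (if k = 0 then 1 else (1 - real p) / real p ^ k)"
  unfolding recip_mobius_def by (rule mult_extension_prime_power)

lemma sum_recip_mobius:
  assumes "n > 0"
  shows "(\<Sum>d | d dvd n. recip_mobius d) = 1 / real n"
proof -
  have "power_divisor_sum 1 recip_mobius n = 1 / real n"
  proof (rule multiplicative_eqI[OF multiplicative_power_divisor_sum _ _ assms])
    show "multiplicative (\<lambda>n. 1 / real n)" by (simp add: multiplicative_def)
    fix p k :: nat assume p: "prime p"
    have p0: "real p > 0" using prime_gt_0_nat[OF p] by simp
    have "(\<Sum>j\<le>k. recip_mobius (p ^ j)) = 1 / real p ^ k"
    proof (induction k)
      case (Suc k)
      then show ?case using p0 by (simp add: recip_mobius_prime_power[OF p] field_simps del: power_Suc of_nat_power)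
         (simp add: field_simps)
    qed (simp add: multiplicative_one[OF multiplicative_recip_mobius])
    then show "power_divisor_sum 1 recip_mobius (p ^ k) = 1 / real (p ^ k)"
      using power_divisor_sum_prime_power[of 1 p recip_mobius k] p by simp
  qed (simp_all add: multiplicative_recip_mobius)
  then show ?thesis by (simp add: power_divisor_sum_def)
qed

text \<open>Expanding each summand by \<open>sum_recip_mobius\<close> and swapping sums leaves, for
  every \<open>d\<close>, the number of multiples of \<open>d ^ b\<close> up to \<open>n\<close>. As
  \<open>d ^ b\<close> divides \<open>n\<close>, this count is exactly
  \<open>n / d ^ b\<close>.\<close>

lemma sum_recip_gen_gcd:
  assumes "b > 0" "n > 0"
  shows "(\<Sum>j=1..n. 1 / real (gen_gcd b j n)) =
    real n * power_divisor_sum b (\<lambda>d. recip_mobius d / real d ^ b) n"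
proof -
  let ?D = "{d. d ^ b dvd n}"
  have fin: "finite ?D" using assms by (rule finite_power_divisors)
  have "1 / real (gen_gcd b j n) = (\<Sum>d\<in>?D. if d ^ b dvd j then recip_mobius d else 0)"
    if "j \<in> {1..n}" for j
  proof -
    have j: "j > 0" using that by simp
    have "1 / real (gen_gcd b j n) = (\<Sum>d | d dvd gen_gcd b j n. recip_mobius d)"
      by (rule sum_recip_mobius[symmetric, OF gen_gcd_pos[OF assms(1) j assms(2)]])
    also have "\<dots> = (\<Sum>d | d \<in> ?D \<and> d ^ b dvd j. recip_mobius d)"
      by (rule sum.cong) (auto simp: dvd_gen_gcd_iff[OF assms(1) j assms(2)])
    also have "\<dots> = (\<Sum>d\<in>?D. if d ^ b dvd j then recip_mobius d else 0)"
      using fin sum.inter_filter[OF fin, of recip_mobius "\<lambda>d. d ^ b dvd j"] by simp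
    finally show ?thesis .
  qed
  then have "(\<Sum>j=1..n. 1 / real (gen_gcd b j n)) =
      (\<Sum>j=1..n. \<Sum>d\<in>?D. if d ^ b dvd j then recip_mobius d else 0)" by (rule sum.cong[OF refl])
  also have "\<dots> = (\<Sum>d\<in>?D. \<Sum>j=1..n. if d ^ b dvd j then recip_mobius d else 0)" by (rule sum.swap)
  also have "\<dots> = (\<Sum>d\<in>?D. real n * (recip_mobius d / real d ^ b))"
  proof (rule sum.cong[OF refl])
    fix d assume "d \<in> ?D"
    then have d: "d ^ b dvd n" by simp
    then have d0: "d ^ b > 0" using power_divisor_pos[OF assms d] by simp
    have "(\<Sum>j=1..n. if d ^ b dvd j then recip_mobius d else 0) =
        (\<Sum>j | j \<in> {1..n} \<and> d ^ b dvd j. recip_mobius d)"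
      by (rule sum.inter_filter[symmetric]) simp
    also have "\<dots> = real (n div d ^ b) * recip_mobius d"
      by (subst sum_multiples[OF d0]) simp
    also have "real (n div d ^ b) = real n / real d ^ b" using d by (simp add: real_of_nat_div)
    finally show "(\<Sum>j=1..n. if d ^ b dvd j then recip_mobius d else 0) =
      real n * (recip_mobius d / real d ^ b)" by simp
  qed
  finally show ?thesis by (simp add: power_divisor_sum_def sum_distrib_left)
qed

text \<open>Both sides are multiplicative, so prime powers suffice; at \<open>p ^ k\<close> both
  equal \<open>1 / local_sum b p (k div b)\<close>.\<close>

lemma harm_mean_gcd_eq:
  assumes b: "b > 0" and n: "n > 0"
  shows "harm_mean_gcd b n = power_divisor_sum b (increment_fun b) n"
proof -
  define w where "w = (\<lambda>d. recip_mobius d / real d ^ b)"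
  have w: "multiplicative w"
    unfolding w_def by (rule multiplicative_divide_power[OF multiplicative_recip_mobius])
  have "1 / power_divisor_sum b w n = power_divisor_sum b (increment_fun b) n"
  proof (rule multiplicative_eqI[OF _ _ _ n])
    show "multiplicative (\<lambda>n. 1 / power_divisor_sum b w n)"
      by (rule multiplicative_inverse[OF multiplicative_power_divisor_sum[OF b w]])
    show "multiplicative (power_divisor_sum b (increment_fun b))"
      by (rule multiplicative_power_divisor_sum[OF b multiplicative_increment_fun])
    fix p k :: nat assume p: "prime p"
    have "(\<Sum>j\<le>k div b. w (p ^ j)) = local_sum b p (k div b)"
      unfolding local_sum_eq[OF prime_ge_2_nat[OF p]] w_def
      by (rule sum.cong) (auto simp: recip_mobius_prime_power[OF p] multiplicative_one[OF multiplicative_recip_mobius])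
    then show "1 / power_divisor_sum b w (p ^ k) = power_divisor_sum b (increment_fun b) (p ^ k)"
      by (simp only: power_divisor_sum_prime_power[OF b p] sum_increment_fun_prime_power[OF p])
  qed
  moreover have "harm_mean_gcd b n = 1 / power_divisor_sum b w n"
    unfolding harm_mean_gcd_def sum_recip_gen_gcd[OF assms] w_def using n by (simp add: field_simps)
  ultimately show ?thesis by simp
qed

section \<open>The logarithmic sum\<close>

text \<open>After swapping sums, writing \<open>n = d ^ b * k\<close> turns the sum of 1/n over
  multiples of \<open>d ^ b\<close> into a harmonic number.\<close>

lemma sum_harm_mean_gcd_over_n:
  assumes b: "b > 0"
  shows "(\<Sum>n=1..N. harm_mean_gcd b n / real n) =
    (\<Sum>d=1..N. increment_fun b d / real d ^ b * harm (N div d ^ b))"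
proof -
  have "harm_mean_gcd b n / real n =
      (\<Sum>d=1..N. if d ^ b dvd n then increment_fun b d / real n else 0)" if n: "n \<in> {1..N}" for n
  proof -
    have n0: "n > 0" using n by simp
    \<comment> \<open>A range for \<open>d\<close> that does not depend on \<open>n\<close> makes
      the double sum rectangular, ready for \<open>sum.swap\<close>.\<close>
    have eq: "{d \<in> {1..N}. d ^ b dvd n} = {d. d ^ b dvd n}"
    proof (intro equalityI subsetI)
      fix d assume "d \<in> {d. d ^ b dvd n}"
      then have d: "d ^ b dvd n" by simp
      show "d \<in> {d \<in> {1..N}. d ^ b dvd n}"
        using d n power_divisor_le[OF b n0 d] power_divisor_pos[OF b n0 d] by simp
    qed simp
    have "harm_mean_gcd b n / real n = (\<Sum>d | d ^ b dvd n. increment_fun b d / real n)"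
      by (simp add: harm_mean_gcd_eq[OF b n0] power_divisor_sum_def sum_divide_distrib)
    also have "\<dots> = (\<Sum>d\<in>{d \<in> {1..N}. d ^ b dvd n}. increment_fun b d / real n)"
      by (simp only: eq)
    also have "\<dots> = (\<Sum>d=1..N. if d ^ b dvd n then increment_fun b d / real n else 0)"
      by (rule sum.inter_filter) simp
    finally show ?thesis .
  qed
  then have "(\<Sum>n=1..N. harm_mean_gcd b n / real n) =
      (\<Sum>n=1..N. \<Sum>d=1..N. if d ^ b dvd n then increment_fun b d / real n else 0)"
    by (rule sum.cong[OF refl])
  also have "\<dots> = (\<Sum>d=1..N. \<Sum>n=1..N. if d ^ b dvd n then increment_fun b d / real n else 0)"
    by (rule sum.swap)
  also have "\<dots> = (\<Sum>d=1..N. increment_fun b d / real d ^ b * harm (N div d ^ b))"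
  proof (rule sum.cong[OF refl])
    fix d assume "d \<in> {1..N}"
    then have d0: "d ^ b > 0" by simp
    have "(\<Sum>n=1..N. if d ^ b dvd n then increment_fun b d / real n else 0) =
        (\<Sum>n | n \<in> {1..N} \<and> d ^ b dvd n. increment_fun b d / real n)"
      by (rule sum.inter_filter[symmetric]) simp
    also have "\<dots> = (\<Sum>k=1..N div d ^ b. increment_fun b d / real (d ^ b * k))"
      by (rule sum_multiples[OF d0])
    also have "\<dots> = increment_fun b d / real d ^ b * harm (N div d ^ b)"
      unfolding harm_def by (simp add: sum_distrib_left divide_inverse mult.assoc)
    finally show "(\<Sum>n=1..N. if d ^ b dvd n then increment_fun b d / real n else 0) =
        increment_fun b d / real d ^ b * harm (N div d ^ b)" .
  qed
  finally show ?thesis .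
qed

text \<open>\<open>harm n - ln n\<close> decreases from its value 1 at \<open>n = 1\<close>; the
  sequence in \<open>decseq_harm_diff_ln\<close> is shifted by one, hence the index
  \<open>n - 1\<close>.\<close>

lemma harm_le_ln: "n > 0 \<Longrightarrow> harm n \<le> ln (real n) + 1"
  using decseqD[OF decseq_harm_diff_ln, of 0 "n - 1"] by (simp add: harm_expand)

text \<open>For the quotient \<open>m\<close>, x lies between \<open>m * d ^ b\<close> and
  \<open>(m + 1) * d ^ b\<close>, while \<open>harm m\<close> lies between \<open>ln (m + 1)\<close>
  and \<open>ln m + 1\<close>. If \<open>m = 0\<close>, the harmonic number is 0 and
  \<open>ln x\<close> is at most \<open>b * ln d\<close>. Covering this case allows the error to be
  summed over all \<open>d\<close>.\<close>

lemma harm_div_power_approx: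
  fixes x :: real
  assumes x: "x \<ge> 1" and d: "d > 0"
  shows "\<bar>harm (nat \<lfloor>x\<rfloor> div d ^ b) - ln x\<bar> \<le> b * ln (real d) + 1"
proof -
  define m where "m = nat \<lfloor>x\<rfloor> div d ^ b"
  have D: "d ^ b > 0" using d by simp
  have lnD: "ln (real (d ^ b)) = b * ln (real d)" using d by (simp add: ln_realpow)
  have lnd: "ln (real d) \<ge> 0" using d by simp
  have "m * d ^ b \<le> nat \<lfloor>x\<rfloor>" unfolding m_def by simp
  then have "real (m * d ^ b) \<le> real (nat \<lfloor>x\<rfloor>)" by (simp only: of_nat_le_iff)
  then have lo: "real (m * d ^ b) \<le> x" using x by linarith
  have "nat \<lfloor>x\<rfloor> < (m + 1) * d ^ b" unfolding m_def using D
    by (metis add.commute dividend_less_div_times mult.commute mult_Suc Suc_eq_plus1)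
  \<comment> \<open>Strictness between integers leaves room for the fractional part of
    \<open>x\<close>.\<close>
  then have "nat \<lfloor>x\<rfloor> + 1 \<le> (m + 1) * d ^ b" by simp
  then have "real (nat \<lfloor>x\<rfloor> + 1) \<le> real ((m + 1) * d ^ b)" by (simp only: of_nat_le_iff)
  then have hi: "x \<le> real (m + 1) * real (d ^ b)" using x by (simp only: of_nat_mult[symmetric]) linarith
  then have "ln x \<le> ln (real (m + 1) * real (d ^ b))" using x by simp
  also have "\<dots> = ln (real (m + 1)) + b * ln (real d)"
    using D lnD by (subst ln_mult) auto
  finally have up: "ln x \<le> ln (real (m + 1)) + b * ln (real d)" .
  show ?thesis
  proof (cases "m = 0")
    case True
    then show ?thesis using up x lnd unfolding m_def[symmetric] by (simp add: harm_def)
  next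
    case False
    have "ln (real m * real (d ^ b)) \<le> ln x" using False D lo x by simp
    then have "ln (real m) + b * ln (real d) \<le> ln x"
      using False D lnD by (subst (asm) ln_mult) auto
    moreover have "harm m \<le> ln (real m) + 1" using False by (simp add: harm_le_ln)
    moreover have "ln (real (m + 1)) \<le> harm m" using ln_le_harm[of m] by (simp add: add.commute)
    moreover have "real b * ln (real d) \<ge> 0" using lnd by simp
    ultimately show ?thesis using up unfolding m_def[symmetric] by linarith
  qed
qed

section \<open>Convergence of the main and error series\<close>

lemma summable_recip_power: "b \<ge> 2 \<Longrightarrow> summable (\<lambda>d. 1 / real d ^ b)"
  using inverse_power_summable[of b, where 'a = real] by (simp add: field_simps)

text \<open>Since ln d = 2 ln (sqrt d) is at most 2 sqrt d, the terms are dominated by 2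
  d^(-3/2).\<close>

lemma summable_ln_over_power:
  assumes "b \<ge> 2"
  shows "summable (\<lambda>d. ln (real d) / real d ^ b)"
proof (rule summable_comparison_test')
  show "summable (\<lambda>d. 2 * real d powr (- 3 / 2))"
    by (intro summable_mult) (simp add: summable_real_powr_iff)
  fix d :: nat assume "d \<ge> 1"
  then have d: "real d \<ge> 1" by simp
  have "ln (real d) = 2 * ln (sqrt (real d))" using d by (simp add: ln_sqrt)
  also have "\<dots> \<le> 2 * sqrt (real d)" using d ln_le_minus_one[of "sqrt (real d)"] by simp
  also have "\<dots> = 2 * real d powr (1 / 2)" using d by (simp add: powr_half_sqrt)
  finally have ln: "ln (real d) \<le> 2 * real d powr (1 / 2)" .
  have "ln (real d) / real d ^ b \<le> 2 * real d powr (1 / 2) / real d ^ 2"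
    using d ln assms by (intro frac_le power_increasing) auto
  also have "\<dots> = 2 * real d powr (1 / 2 - 2)"
    unfolding powr_diff using d by simp
  also have "\<dots> = 2 * real d powr (- 3 / 2)" by simp
  finally show "norm (ln (real d) / real d ^ b) \<le> 2 * real d powr (- 3 / 2)"
    using d by simp
qed

text \<open>The first series is the coefficient of \<open>ln x\<close>; the second dominates the
  total error. Both follow from \<open>increment_fun_bounds\<close> by comparison.\<close>

lemma summable_increment_fun_series:
  assumes "b \<ge> 2"
  shows "summable (\<lambda>d. increment_fun b d / real d ^ b)"
    and "summable (\<lambda>d. increment_fun b d / real d ^ b * (b * ln (real d) + 1))"
proof -
  have G: "0 \<le> increment_fun b d" "increment_fun b d \<le> 1" for d
    using increment_fun_bounds[of b d] assms by auto
  show "summable (\<lambda>d. increment_fun b d / real d ^ b)"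
    by (rule summable_comparison_test'[OF summable_recip_power[OF assms]])
      (use G in \<open>auto intro!: divide_right_mono\<close>)
  have "summable (\<lambda>d. b * (ln (real d) / real d ^ b) + 1 / real d ^ b)"
    by (intro summable_add summable_mult summable_ln_over_power summable_recip_power assms)
  then show "summable (\<lambda>d. increment_fun b d / real d ^ b * (b * ln (real d) + 1))"
  proof (rule summable_comparison_test'[where N = 1])
    fix d :: nat assume d: "d \<ge> 1"
    have "increment_fun b d / real d ^ b * (b * ln (real d) + 1) \<le> 1 / real d ^ b * (b * ln (real d) + 1)"
      using G[of d] d by (intro mult_right_mono divide_right_mono) auto
    also have "\<dots> = b * (ln (real d) / real d ^ b) + 1 / real d ^ b"
      by (simp add: distrib_left)
    finally show "norm (increment_fun b d / real d ^ b * (b * ln (real d) + 1)) \<le>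
        b * (ln (real d) / real d ^ b) + 1 / real d ^ b"
      using G[of d] d by simp
  qed
qed

section \<open>The constant\<close>

text \<open>Put \<open>y = 1 / p ^ b\<close>, \<open>f k = 1 / local_sum b p k\<close> and let
  \<open>E\<close> be the sum of \<open>f k * y ^ k\<close>. Summation by parts gives
  \<open>(1 - y) * E\<close> for the series of increments, the zeta factor
  \<open>1 / (1 - y)\<close> cancels \<open>1 - y\<close>, and \<open>E\<close> is the Euler factor
  in closed form.\<close>

lemma euler_factor_eq:
  assumes b: "b \<ge> 2" and p: "prime p"
  shows "euler_factor b p =
    (\<Sum>k. 1 / real (p ^ k) ^ b) * (\<Sum>k. increment_fun b (p ^ k) / real (p ^ k) ^ b)"
proof -
  define Q where "Q = real p ^ (b + 1)"
  define y where "y = 1 / real p ^ b"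
  define f where "f k = 1 / local_sum b p k" for k
  have p2: "p \<ge> 2" "real p > 1" using prime_ge_2_nat[OF p] by auto
  have "real p ^ 1 < Q" unfolding Q_def using p2 b by (intro power_strict_increasing) auto
  then have Q: "Q > real p" "Q > 1" using p2 by auto
  have y_pow: "1 / real (p ^ k) ^ b = y ^ k" for k
    unfolding y_def by (simp add: power_divide mult.commute flip: power_mult)
  have y_Q: "y ^ k = real p ^ k / Q ^ k" for k
    using p2 by (simp add: y_def Q_def power_divide power_mult_distrib)
  have "real p ^ b > 1" using p2 b by (intro one_less_power) auto
  then have y: "0 < y" "y < 1" using p2 by (auto simp: y_def)
  have f: "0 \<le> f k" "f k \<le> 2" for k
    using local_sum_bounds(2)[of b p k] b p2 by (auto simp: f_def divide_le_eq)
  have f0: "f 0 = 1" by (simp add: f_def local_sum_0[OF p2(1)])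
  have "summable (\<lambda>k. f k * y ^ k)"
  proof (rule summable_comparison_test')
    show "summable (\<lambda>k. 2 * y ^ k)" using y by (intro summable_mult summable_geometric) simp
    show "norm (f k * y ^ k) \<le> 2 * y ^ k" if "k \<ge> 0" for k using f[of k] y by (simp add: abs_mult)
  qed
  then obtain E where E: "(\<lambda>k. f k * y ^ k) sums E" by (auto simp: summable_def)
  have E1: "(\<lambda>k. f (Suc k) * y ^ Suc k) sums (E - 1)"
    using E f0 by (subst sums_Suc_iff) simp
  have yE: "(\<lambda>k. f k * y ^ Suc k) sums (y * E)"
    using sums_mult[OF E, of y] by (simp add: mult_ac)
  have inc: "increment_fun b (p ^ Suc k) = f (Suc k) - f k" for k
    using sum_increment_fun_prime_power[OF p, of b "Suc k"] sum_increment_fun_prime_power[OF p, of b k]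
    by (simp add: f_def del: power_Suc)
  have "(\<lambda>k. increment_fun b (p ^ Suc k) * y ^ Suc k) sums (E - 1 - y * E)"
    unfolding inc left_diff_distrib by (rule sums_diff[OF E1 yE])
  \<comment> \<open>The final 1 is the term at \<open>k = 0\<close>.\<close>
  then have "(\<lambda>k. increment_fun b (p ^ k) * y ^ k) sums (E - 1 - y * E + 1)"
    using sums_Suc_iff[of "\<lambda>k. increment_fun b (p ^ k) * y ^ k" "E - 1 - y * E"]
    by (simp add: multiplicative_one[OF multiplicative_increment_fun])
  moreover have "increment_fun b (p ^ k) * y ^ k = increment_fun b (p ^ k) / real (p ^ k) ^ b" for k
    unfolding y_pow[symmetric] by simp
  moreover have "E - 1 - y * E + 1 = (1 - y) * E" by (simp add: algebra_simps)
  ultimately have "(\<lambda>k. increment_fun b (p ^ k) / real (p ^ k) ^ b) sums ((1 - y) * E)"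
    by (simp only:)
  then have B: "(\<Sum>k. increment_fun b (p ^ k) / real (p ^ k) ^ b) = (1 - y) * E"
    by (rule sums_unique[symmetric])
  have A: "(\<Sum>k. 1 / real (p ^ k) ^ b) = 1 / (1 - y)"
    unfolding y_pow using y by (intro suminf_geometric) simp
  \<comment> \<open>With \<open>R = Q ^ Suc k\<close>, the factor \<open>R\<close> in the numerator
    of \<open>f (Suc k)\<close> cancels against \<open>y ^ Suc k = p ^ Suc k / R\<close>.\<close>
  have eqs: "f (Suc k) * y ^ Suc k = (Q - 1) * (real p ^ Suc k /
      (real p ^ (Suc k * (b + 1)) * (Q - real p) + real p - 1))" for k
  proof -
    define R where "R = Q ^ Suc k"
    have R: "R > 0" unfolding R_def using Q by simp
    have "real p ^ (Suc k * (b + 1)) = R" unfolding R_def Q_def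
      by (metis mult.commute power_mult)
    moreover have "R * (Q - real p) + real p - 1 > 0"
      using R Q p2 by (smt (verit) mult_pos_pos)
    moreover have "local_sum b p (Suc k) = (R * (Q - real p) + real p - 1) / (R * (Q - 1))"
      unfolding local_sum_def Q_def[symmetric] R_def[symmetric] using R Q by (simp add: field_simps)
    ultimately show ?thesis unfolding f_def y_Q R_def[symmetric] using R Q by simp
  qed
  have "(\<lambda>k. (Q - 1) * (real p ^ Suc k /
      (real p ^ (Suc k * (b + 1)) * (Q - real p) + real p - 1))) sums (E - 1)"
    using E1 unfolding eqs .
  then have "(\<lambda>k. real p ^ Suc k /
      (real p ^ (Suc k * (b + 1)) * (Q - real p) + real p - 1)) sums ((E - 1) / (Q - 1))"
    using sums_mult_D[of "Q - 1"] Q by simp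
  then have "euler_factor b p = 1 + (Q - 1) * ((E - 1) / (Q - 1))"
    unfolding euler_factor_def Q_def[symmetric] by (simp only: sums_unique[symmetric])
  also have "\<dots> = E" using Q by simp
  also have "\<dots> = 1 / (1 - y) * ((1 - y) * E)" using y by simp
  finally show ?thesis by (simp only: A B)
qed

text \<open>The term at \<open>d = 0\<close> is 0 by the convention for division by zero, so the
  index can be shifted.\<close>

lemma riemann_zeta_nat:
  assumes "b \<ge> 2"
  shows "riemann_zeta (real b) = (\<Sum>d. 1 / real d ^ b)"
proof -
  have "(\<Sum>d. 1 / real d ^ b) = (\<Sum>d. 1 / real (Suc d) ^ b)"
    using suminf_split_head[OF summable_recip_power[OF assms]] assms by (simp add: zero_power)
  then show ?thesis unfolding riemann_zeta_def by (simp add: powr_realpow)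
qed

text \<open>By \<open>euler_factor_eq\<close> the product over primes is the product of two Euler
  products, one for zeta(b) and one for the series of \<open>v\<close>; dividing by zeta(b) leaves
  the latter.\<close>

lemma C_const_eq:
  assumes b: "b \<ge> 2"
  shows "C_const b = (\<Sum>d. increment_fun b d / real d ^ b)"
proof -
  define z where "z = (\<lambda>d. 1 / real d ^ b)"
  define v where "v = (\<lambda>d. increment_fun b d / real d ^ b)"
  define e where "e p = (if prime p then euler_factor b p else 1)" for p :: nat
  have mz: "multiplicative z"
    using multiplicative_divide_power[of "\<lambda>_. 1" b] by (simp add: z_def multiplicative_def)
  have mv: "multiplicative v"
    unfolding v_def by (rule multiplicative_divide_power[OF multiplicative_increment_fun])
  have pos: "0 \<le> z d" "0 \<le> v d" for d
    using increment_fun_bounds[of b d] b by (auto simp: z_def v_def)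
  have zero: "z 0 = 0" "v 0 = 0" using b by (auto simp: z_def v_def)
  have sm: "summable z" "summable v"
    unfolding z_def v_def by (intro summable_recip_power summable_increment_fun_series b)+
  have ge1: "1 \<le> suminf u" if "summable u" "\<And>d. 0 \<le> u d" "u i = 1" for u :: "nat \<Rightarrow> real" and i
    using sum_le_suminf[OF that(1), of "{i}"] that(2,3) by simp
  have sz: "1 \<le> suminf z" "1 \<le> suminf v"
    by (rule ge1[where i = "Suc 0"]; simp add: sm pos multiplicative_one[OF mz] multiplicative_one[OF mv])+
  have e: "e p = (if prime p then \<Sum>k. z (p ^ k) else 1) * (if prime p then \<Sum>k. v (p ^ k) else 1)" for p
    unfolding e_def z_def v_def using euler_factor_eq[OF b] by simp
  \<comment> \<open>Convergence as an infinite product requires a nonzero limit. The factors and the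
    limit are nonzero because each is a product of two nonnegative series having a term equal to
    1.\<close>
  have nz: "e p \<noteq> 0" for p
  proof (cases "prime p")
    case True
    have "1 \<le> (\<Sum>k. z (p ^ k))" "1 \<le> (\<Sum>k. v (p ^ k))"
      by (rule ge1[where i = 0];
          simp add: summable_prime_powers[OF _ _ True] sm pos multiplicative_one[OF mz] multiplicative_one[OF mv])+
    then show ?thesis by (simp add: e)
  qed (simp add: e_def)
  have lim: "(\<lambda>N. \<Prod>p\<le>N. e p) \<longlonglongrightarrow> suminf z * suminf v"
    unfolding e prod.distrib
    by (intro tendsto_mult euler_product_LIMSEQ mz mv pos zero sm)
  have "convergent_prod e"
    using lim sz by (subst convergent_prod_iff_nz_lim[OF nz]) (auto intro!: exI[of _ "suminf z * suminf v"])
  then have "prodinf e = suminf z * suminf v"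
    using prodinf_eq_lim[OF _ nz] limI[OF lim] by simp
  then have "C_const b = 1 / suminf z * (suminf z * suminf v)"
    unfolding C_const_def e_def[symmetric] riemann_zeta_nat[OF b] z_def by simp
  then show ?thesis using sz by (simp add: v_def)
qed

theorem theorem1p4:
  fixes b :: nat
  assumes "b \<ge> 2"
  shows "(\<lambda>x::real. (\<Sum>n | 1 \<le> n \<and> real n \<le> x. harm_mean_gcd b n / real n) - C_const b * ln x)
           \<in> O[at_top](\<lambda>_. 1)"
proof -
  define v where "v = (\<lambda>d. increment_fun b d / real d ^ b)"
  \<comment> \<open>The total error over all \<open>d\<close>, free of \<open>x\<close>; it becomes
    the implied constant.\<close>
  define K where "K = (\<Sum>d. v d * (b * ln (real d) + 1))"
  have b0: "b > 0" using assms by simp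
  have v: "0 \<le> v d" for d using increment_fun_bounds[of b d] assms by (simp add: v_def)
  have v0: "v 0 = 0" using assms by (simp add: v_def)
  have sv: "summable v" "summable (\<lambda>d. v d * (b * ln (real d) + 1))"
    using summable_increment_fun_series[OF assms] by (simp_all add: v_def)
  have C: "C_const b = suminf v" using C_const_eq[OF assms] by (simp add: v_def)
  have bound: "\<bar>(\<Sum>n | 1 \<le> n \<and> real n \<le> x. harm_mean_gcd b n / real n) - C_const b * ln x\<bar> \<le> K"
    if x: "x \<ge> 1" for x
  proof -
    define N where "N = nat \<lfloor>x\<rfloor>"
    define w where "w d = (harm (N div d ^ b) :: real)" for d
    have "{n. 1 \<le> n \<and> real n \<le> x} = {1..N}" unfolding N_def using x by (auto simp: le_nat_floor) linarith
    then have "(\<Sum>n | 1 \<le> n \<and> real n \<le> x. harm_mean_gcd b n / real n) = (\<Sum>d=1..N. v d * w d)"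
      using sum_harm_mean_gcd_over_n[OF b0] by (simp add: v_def w_def)
    \<comment> \<open>The finite sum is read as a series over all \<open>d\<close>, to be compared
      termwise with \<open>ln x\<close> times the series of \<open>v\<close>. For
      \<open>d > N\<close> the quotient is 0 and so is \<open>harm 0\<close>.\<close>
    moreover have "(\<lambda>d. v d * w d) sums (\<Sum>d=1..N. v d * w d)"
    proof (rule sums_finite)
      fix d assume "d \<notin> {1..N}"
      then consider "d = 0" | "d > N" by force
      then show "v d * w d = 0"
      proof cases
        case 2
        have "d \<le> d ^ b" using 2 b0 by (simp add: self_le_power)
        then have "N < d ^ b" using 2 by simp
        then show ?thesis by (simp add: w_def harm_def)
      qed (simp add: v0)
    qed simp
    moreover have "(\<lambda>d. v d * ln x) sums (C_const b * ln x)"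
      unfolding C by (intro sums_mult2 summable_sums sv)
    ultimately have S: "(\<lambda>d. v d * (w d - ln x)) sums
        ((\<Sum>n | 1 \<le> n \<and> real n \<le> x. harm_mean_gcd b n / real n) - C_const b * ln x)"
      by (simp add: sums_diff right_diff_distrib)
    have le: "norm (v d * (w d - ln x)) \<le> v d * (b * ln (real d) + 1)" for d
    proof (cases "d = 0")
      case False
      then show ?thesis unfolding w_def N_def
        using harm_div_power_approx[OF x, of d b] v[of d] by (simp add: abs_mult mult_left_mono)
    qed (simp add: v0)
    have "norm (\<Sum>d. v d * (w d - ln x)) \<le> K"
      unfolding K_def by (rule norm_suminf_le[OF le sv(2)])
    then show ?thesis using sums_unique[OF S] by simp
  qed
  show ?thesis
    by (rule bigoI[of _ K]) (use bound in \<open>auto intro!: eventually_at_top_linorderI[of 1]\<close>)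
qed

end
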